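(* Let $(L,\tau)$ be a compact topological residuated lattice. Then the following conditions are equivalent: (i) $(L,\tau)$ is profinite; (ii) there is a set $\mathcal S$ of clopen filters of $L$ such that (a) $(\mathcal S,\supseteq)$ is directed, i.e. for all $F,G\in\mathcal S$ there is $H\in\mathcal S$ with $H\subseteq F\cap G$; and (b) for all distinct $x,y\in L$ there is $F\in\mathcal S$ such that $x/F\neq y/F$.
   Context: A residuated lattice is an algebra $(L,\wedge,\vee,\odot,\rightarrow,0,1)$ such that $(L,\wedge,\vee,0,1)$ is a bounded lattice, $(L,\odot,1)$ is a commutative monoid, and $x\odot y\leq z$ iff $x\leq y\rightarrow z$ for all $x,y,z\in L$. Homomorphisms preserve all these operations and constants. A filter of $L$ is a nonempty subset $F\subseteq L$ closed under $\odot$ and upward closed. For a filter $F$, $\theta_F=\{(x,y)\in L\times L:(x\to y)\odot(y\to x)\in F\}$ is a congruence of $L$, and $x/F$ denotes the $\theta_F$-class of $x$. A topological residuated lattice $(L,\tau)$ is a residuated lattice with a topology $\tau$ for which all operations are continuous. Compact means that every open cover has a finite subcover (Hausdorffness is not included). $(L,\tau)$ is profinite if it is topologically isomorphic (isomorphic via an algebra isomorphism that is a homeomorphism) to the inverse limit of an inverse system (indexed by a directed poset, with homomorphisms as connecting maps) of finite discrete residuated lattices; the inverse limit $\{(b_i)\in\prod_i L_i:\pi_{ij}(b_i)=b_j \text{ for } j\le i\}$ carries the subspace topology of the product topology. *)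

theory Defs
  imports "HOL-Analysis.Analysis" "HOL-Algebra.Group"
begin

text \<open>
  The monoid operation, its unit (which is also the top of the lattice) and the carrier are
  inherited from the library record for monoids.
\<close>

record 'a reslat = "'a monoid" +
  rl_meet :: "'a \<Rightarrow> 'a \<Rightarrow> 'a" (infixl "\<curlywedge>\<index>" 70)
  rl_join :: "'a \<Rightarrow> 'a \<Rightarrow> 'a" (infixl "\<curlyvee>\<index>" 65)
  rl_imp :: "'a \<Rightarrow> 'a \<Rightarrow> 'a" (infixr "\<leadsto>\<index>" 60)
  rl_zero :: "'a"

definition rl_le :: "('a, 'm) reslat_scheme \<Rightarrow> 'a \<Rightarrow> 'a \<Rightarrow> bool" where
  "rl_le L x y \<longleftrightarrow> rl_meet L x y = x"

locale residuated_lattice = comm_monoid L for L (structure) +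
  assumes meet_closed: "\<lbrakk>x \<in> carrier L; y \<in> carrier L\<rbrakk> \<Longrightarrow> x \<curlywedge> y \<in> carrier L"
    and join_closed: "\<lbrakk>x \<in> carrier L; y \<in> carrier L\<rbrakk> \<Longrightarrow> x \<curlyvee> y \<in> carrier L"
    and imp_closed: "\<lbrakk>x \<in> carrier L; y \<in> carrier L\<rbrakk> \<Longrightarrow> x \<leadsto> y \<in> carrier L"
    and zero_closed: "rl_zero L \<in> carrier L"
    and meet_comm: "\<lbrakk>x \<in> carrier L; y \<in> carrier L\<rbrakk> \<Longrightarrow> x \<curlywedge> y = y \<curlywedge> x"
    and join_comm: "\<lbrakk>x \<in> carrier L; y \<in> carrier L\<rbrakk> \<Longrightarrow> x \<curlyvee> y = y \<curlyvee> x"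
    and meet_assoc: "\<lbrakk>x \<in> carrier L; y \<in> carrier L; z \<in> carrier L\<rbrakk>
                      \<Longrightarrow> (x \<curlywedge> y) \<curlywedge> z = x \<curlywedge> (y \<curlywedge> z)"
    and join_assoc: "\<lbrakk>x \<in> carrier L; y \<in> carrier L; z \<in> carrier L\<rbrakk>
                      \<Longrightarrow> (x \<curlyvee> y) \<curlyvee> z = x \<curlyvee> (y \<curlyvee> z)"
    and meet_absorb: "\<lbrakk>x \<in> carrier L; y \<in> carrier L\<rbrakk> \<Longrightarrow> x \<curlywedge> (x \<curlyvee> y) = x"
    and join_absorb: "\<lbrakk>x \<in> carrier L; y \<in> carrier L\<rbrakk> \<Longrightarrow> x \<curlyvee> (x \<curlywedge> y) = x"
    and zero_le: "x \<in> carrier L \<Longrightarrow> rl_le L (rl_zero L) x"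
    and le_one: "x \<in> carrier L \<Longrightarrow> rl_le L x \<one>"
    and residuation: "\<lbrakk>x \<in> carrier L; y \<in> carrier L; z \<in> carrier L\<rbrakk>
                      \<Longrightarrow> rl_le L (x \<otimes> y) z \<longleftrightarrow> rl_le L x (y \<leadsto> z)"

definition rl_hom :: "('a, 'm) reslat_scheme \<Rightarrow> ('b, 'n) reslat_scheme \<Rightarrow> ('a \<Rightarrow> 'b) set" where
  "rl_hom L M = {h \<in> hom L M.
     (\<forall>x\<in>carrier L. \<forall>y\<in>carrier L.
        h (x \<curlywedge>\<^bsub>L\<^esub> y) = h x \<curlywedge>\<^bsub>M\<^esub> h y \<and>
        h (x \<curlyvee>\<^bsub>L\<^esub> y) = h x \<curlyvee>\<^bsub>M\<^esub> h y \<and>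
        h (x \<leadsto>\<^bsub>L\<^esub> y) = h x \<leadsto>\<^bsub>M\<^esub> h y) \<and>
     h (rl_zero L) = rl_zero M \<and> h \<one>\<^bsub>L\<^esub> = \<one>\<^bsub>M\<^esub>}"

definition rl_filter :: "('a, 'm) reslat_scheme \<Rightarrow> 'a set \<Rightarrow> bool" where
  "rl_filter L F \<longleftrightarrow> F \<noteq> {} \<and> F \<subseteq> carrier L \<and>
     (\<forall>x\<in>F. \<forall>y\<in>F. x \<otimes>\<^bsub>L\<^esub> y \<in> F) \<and>
     (\<forall>x\<in>F. \<forall>y\<in>carrier L. rl_le L x y \<longrightarrow> y \<in> F)"

definition filter_cong :: "('a, 'm) reslat_scheme \<Rightarrow> 'a set \<Rightarrow> ('a \<times> 'a) set" where
  "filter_cong L F = {(x, y) \<in> carrier L \<times> carrier L.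
     (x \<leadsto>\<^bsub>L\<^esub> y) \<otimes>\<^bsub>L\<^esub> (y \<leadsto>\<^bsub>L\<^esub> x) \<in> F}"

definition filter_class :: "('a, 'm) reslat_scheme \<Rightarrow> 'a \<Rightarrow> 'a set \<Rightarrow> 'a set" where
  "filter_class L x F = filter_cong L F `` {x}"

definition topological_residuated_lattice :: "('a, 'm) reslat_scheme \<Rightarrow> 'a topology \<Rightarrow> bool" where
  "topological_residuated_lattice L \<tau> \<longleftrightarrow> residuated_lattice L \<and> topspace \<tau> = carrier L \<and>
     continuous_map (prod_topology \<tau> \<tau>) \<tau> (\<lambda>(x, y). x \<curlywedge>\<^bsub>L\<^esub> y) \<and>
     continuous_map (prod_topology \<tau> \<tau>) \<tau> (\<lambda>(x, y). x \<curlyvee>\<^bsub>L\<^esub> y) \<and>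
     continuous_map (prod_topology \<tau> \<tau>) \<tau> (\<lambda>(x, y). x \<otimes>\<^bsub>L\<^esub> y) \<and>
     continuous_map (prod_topology \<tau> \<tau>) \<tau> (\<lambda>(x, y). x \<leadsto>\<^bsub>L\<^esub> y)"

text \<open>
  Orders on index sets are relations: \<open>(j, i) \<in> r\<close> means \<open>j \<le> i\<close>, and then
  \<open>p i j\<close> is the connecting map from \<open>A i\<close> to \<open>A j\<close>.
\<close>

definition directed_poset :: "'i set \<Rightarrow> 'i rel \<Rightarrow> bool" where
  "directed_poset I r \<longleftrightarrow> partial_order_on I r \<and> I \<noteq> {} \<and>
     (\<forall>i\<in>I. \<forall>j\<in>I. \<exists>k\<in>I. (i, k) \<in> r \<and> (j, k) \<in> r)"

definition inverse_system ::
    "'i set \<Rightarrow> 'i rel \<Rightarrow> ('i \<Rightarrow> ('b, 'n) reslat_scheme) \<Rightarrow> ('i \<Rightarrow> 'i \<Rightarrow> 'b \<Rightarrow> 'b) \<Rightarrow> bool" where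
  "inverse_system I r A p \<longleftrightarrow> directed_poset I r \<and>
     (\<forall>i\<in>I. residuated_lattice (A i)) \<and>
     (\<forall>(j, i)\<in>r. p i j \<in> rl_hom (A i) (A j)) \<and>
     (\<forall>i\<in>I. \<forall>x\<in>carrier (A i). p i i x = x) \<and>
     (\<forall>i\<in>I. \<forall>j\<in>I. \<forall>k\<in>I. (k, j) \<in> r \<longrightarrow> (j, i) \<in> r \<longrightarrow>
        (\<forall>x\<in>carrier (A i). p j k (p i j x) = p i k x))"

definition inverse_limit ::
    "'i set \<Rightarrow> 'i rel \<Rightarrow> ('i \<Rightarrow> ('b, 'n) reslat_scheme) \<Rightarrow> ('i \<Rightarrow> 'i \<Rightarrow> 'b \<Rightarrow> 'b) \<Rightarrow> ('i \<Rightarrow> 'b) reslat" where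
  "inverse_limit I r A p =
     \<lparr>carrier = {b \<in> \<Pi>\<^sub>E i\<in>I. carrier (A i). \<forall>(j, i)\<in>r. p i j (b i) = b j},
      mult = (\<lambda>b c. \<lambda>i\<in>I. b i \<otimes>\<^bsub>A i\<^esub> c i),
      one = (\<lambda>i\<in>I. \<one>\<^bsub>A i\<^esub>),
      rl_meet = (\<lambda>b c. \<lambda>i\<in>I. b i \<curlywedge>\<^bsub>A i\<^esub> c i),
      rl_join = (\<lambda>b c. \<lambda>i\<in>I. b i \<curlyvee>\<^bsub>A i\<^esub> c i),
      rl_imp = (\<lambda>b c. \<lambda>i\<in>I. b i \<leadsto>\<^bsub>A i\<^esub> c i),
      rl_zero = (\<lambda>i\<in>I. rl_zero (A i))\<rparr>"

definition inverse_limit_topology ::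
    "'i set \<Rightarrow> 'i rel \<Rightarrow> ('i \<Rightarrow> ('b, 'n) reslat_scheme) \<Rightarrow> ('i \<Rightarrow> 'i \<Rightarrow> 'b \<Rightarrow> 'b) \<Rightarrow> ('i \<Rightarrow> 'b) topology" where
  "inverse_limit_topology I r A p =
     subtopology (product_topology (\<lambda>i. discrete_topology (carrier (A i))) I)
       (carrier (inverse_limit I r A p))"

definition topologically_isomorphic ::
    "('a, 'm) reslat_scheme \<Rightarrow> 'a topology \<Rightarrow> ('b, 'n) reslat_scheme \<Rightarrow> 'b topology \<Rightarrow> bool" where
  "topologically_isomorphic L \<tau> M \<sigma> \<longleftrightarrow>
     (\<exists>h \<in> rl_hom L M. bij_betw h (carrier L) (carrier M) \<and> homeomorphic_map \<tau> \<sigma> h)"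

text \<open>
  HOL cannot quantify over types inside a formula, so the type \<open>'i\<close> of the indices and the type
  \<open>'b\<close> containing the carriers of all members of the inverse system are parameters here.
\<close>

definition profinite_over ::
    "'i itself \<Rightarrow> 'b itself \<Rightarrow> ('a, 'm) reslat_scheme \<Rightarrow> 'a topology \<Rightarrow> bool" where
  "profinite_over ti tb L \<tau> \<longleftrightarrow>
     (\<exists>(I :: 'i set) r (A :: 'i \<Rightarrow> 'b reslat) p.
        inverse_system I r A p \<and> (\<forall>i\<in>I. finite (carrier (A i))) \<and>
        topologically_isomorphic L \<tau> (inverse_limit I r A p) (inverse_limit_topology I r A p))"

text \<open>
  For a lattice with elements in \<open>'a\<close> we index by sets of elements (such as filters) and take
  lattices whose elements are sets of elements (such as congruence classes).  For compact
  topological residuated lattices this choice is no restriction: \<open>profinite_over\<close> for any other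
  pair of types implies \<open>profinite\<close>, as the main theorem also asserts.
\<close>

definition profinite :: "('a, 'm) reslat_scheme \<Rightarrow> 'a topology \<Rightarrow> bool" where
  "profinite L \<tau> \<longleftrightarrow> profinite_over TYPE('a set) TYPE('a set) L \<tau>"

end

theory Submission
  imports Defs
begin

text \<open>
  For a profinite \<open>L\<close>, the kernels of the projections to the members of the inverse system are
  clopen filters; they are directed because the index set is, and they separate points because
  the projections do.  Conversely, the classes of a clopen filter are clopen, so by compactness
  the quotients by the filters in \<open>S\<close> are finite.  The canonical map from \<open>L\<close> to the limit of
  these quotients is injective by separation and surjective because, by compactness, a compatible
  family of (closed) classes has a common point.  Being a continuous bijection from a compact
  space onto a Hausdorff space, it is a homeomorphism.
\<close>

section \<open>Residuated lattices\<close>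

context residuated_lattice
begin

section \<open>The lattice order\<close>

abbreviation le (infix "\<preceq>" 50) where "x \<preceq> y \<equiv> rl_le L x y"

lemmas op_closed [simp, intro] = meet_closed join_closed imp_closed zero_closed

text \<open>Idempotence of meet is not an axiom; it comes from substituting one absorption law into
  the other.\<close>

lemma le_refl [simp]: "x \<in> carrier L \<Longrightarrow> x \<preceq> x"
  unfolding rl_le_def by (metis join_absorb meet_absorb meet_closed)

lemma le_antisym: "\<lbrakk>x \<preceq> y; y \<preceq> x; x \<in> carrier L; y \<in> carrier L\<rbrakk> \<Longrightarrow> x = y"
  unfolding rl_le_def by (metis meet_comm)

lemma le_trans: "\<lbrakk>x \<preceq> y; y \<preceq> z; x \<in> carrier L; y \<in> carrier L; z \<in> carrier L\<rbrakk> \<Longrightarrow> x \<preceq> z"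
  unfolding rl_le_def by (metis meet_assoc)

lemma meet_le1: "\<lbrakk>x \<in> carrier L; y \<in> carrier L\<rbrakk> \<Longrightarrow> x \<curlywedge> y \<preceq> x"
  unfolding rl_le_def by (metis le_refl rl_le_def meet_assoc meet_comm meet_closed)

lemma meet_le2: "\<lbrakk>x \<in> carrier L; y \<in> carrier L\<rbrakk> \<Longrightarrow> x \<curlywedge> y \<preceq> y"
  by (metis meet_le1 meet_comm)

lemma le_meet:
  "\<lbrakk>z \<preceq> x; z \<preceq> y; x \<in> carrier L; y \<in> carrier L; z \<in> carrier L\<rbrakk> \<Longrightarrow> z \<preceq> x \<curlywedge> y"
  unfolding rl_le_def by (metis meet_assoc)

lemma le_join1: "\<lbrakk>x \<in> carrier L; y \<in> carrier L\<rbrakk> \<Longrightarrow> x \<preceq> x \<curlyvee> y"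
  unfolding rl_le_def by (rule meet_absorb)

lemma le_join2: "\<lbrakk>x \<in> carrier L; y \<in> carrier L\<rbrakk> \<Longrightarrow> y \<preceq> x \<curlyvee> y"
  by (metis le_join1 join_comm)

lemma le_iff_join: "\<lbrakk>x \<in> carrier L; y \<in> carrier L\<rbrakk> \<Longrightarrow> x \<preceq> y \<longleftrightarrow> x \<curlyvee> y = y"
  unfolding rl_le_def by (metis join_absorb join_comm meet_absorb meet_comm)

lemma join_le:
  "\<lbrakk>x \<preceq> z; y \<preceq> z; x \<in> carrier L; y \<in> carrier L; z \<in> carrier L\<rbrakk> \<Longrightarrow> x \<curlyvee> y \<preceq> z"
  by (simp add: le_iff_join join_assoc)

section \<open>Consequences of residuation\<close>

lemma imp_mp: "\<lbrakk>x \<in> carrier L; y \<in> carrier L\<rbrakk> \<Longrightarrow> (x \<leadsto> y) \<otimes> x \<preceq> y"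
  by (simp add: residuation)

text \<open>Multiplication by \<open>z\<close> is a left adjoint, hence monotone: compose the unit
  \<open>y \<preceq> z \<leadsto> y \<otimes> z\<close> of the adjunction with
  \<open>x \<preceq> y\<close> and residuate back.\<close>

lemma mult_mono_left:
  assumes "x \<preceq> y" "x \<in> carrier L" "y \<in> carrier L" "z \<in> carrier L"
  shows "x \<otimes> z \<preceq> y \<otimes> z"
proof -
  have "y \<preceq> z \<leadsto> y \<otimes> z"
    using assms residuation [of y z "y \<otimes> z"] by simp
  then show ?thesis
    using assms le_trans residuation by simp
qed

lemma mult_mono_right:
  "\<lbrakk>x \<preceq> y; x \<in> carrier L; y \<in> carrier L; z \<in> carrier L\<rbrakk> \<Longrightarrow> z \<otimes> x \<preceq> z \<otimes> y"
  by (metis m_comm mult_mono_left)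

text \<open>Integrality: the monoid unit is the top element, so multiplying can only
  decrease.\<close>

lemma mult_le1: "\<lbrakk>x \<in> carrier L; y \<in> carrier L\<rbrakk> \<Longrightarrow> x \<otimes> y \<preceq> x"
  using mult_mono_right [of y \<one> x] by (simp add: le_one)

lemma mult_le2: "\<lbrakk>x \<in> carrier L; y \<in> carrier L\<rbrakk> \<Longrightarrow> x \<otimes> y \<preceq> y"
  by (metis mult_le1 m_comm)

lemma one_le_iff: "x \<in> carrier L \<Longrightarrow> \<one> \<preceq> x \<longleftrightarrow> x = \<one>"
  using le_antisym le_one by auto

text \<open>Residuation with \<open>\<one>\<close> as left factor. It turns order relations into
  equations that homomorphisms preserve.\<close>

lemma imp_eq_one_iff: "\<lbrakk>x \<in> carrier L; y \<in> carrier L\<rbrakk> \<Longrightarrow> x \<leadsto> y = \<one> \<longleftrightarrow> x \<preceq> y"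
  by (metis imp_closed l_one one_closed one_le_iff residuation)

text \<open>Currying: by residuation and associativity both sides have the same lower bounds
  \<open>w\<close>, so each lies below the other.\<close>

lemma imp_mult:
  assumes [simp]: "x \<in> carrier L" "y \<in> carrier L" "z \<in> carrier L"
  shows "x \<otimes> y \<leadsto> z = x \<leadsto> (y \<leadsto> z)"
proof -
  have eq: "w \<preceq> x \<otimes> y \<leadsto> z \<longleftrightarrow> w \<preceq> x \<leadsto> (y \<leadsto> z)" if "w \<in> carrier L" for w
    using that by (simp flip: residuation add: m_assoc)
  show ?thesis
    using eq [of "x \<otimes> y \<leadsto> z"] eq [of "x \<leadsto> (y \<leadsto> z)"]
    by (intro le_antisym) simp_all
qed

text \<open>After residuating, modus ponens is applied twice, first from \<open>x\<close> to
  \<open>y\<close> and then from \<open>y\<close> to \<open>z\<close>.\<close>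

lemma imp_trans_le:
  assumes [simp]: "x \<in> carrier L" "y \<in> carrier L" "z \<in> carrier L"
  shows "(x \<leadsto> y) \<otimes> (y \<leadsto> z) \<preceq> x \<leadsto> z"
proof -
  have "(y \<leadsto> z) \<otimes> ((x \<leadsto> y) \<otimes> x) \<preceq> (y \<leadsto> z) \<otimes> y"
    by (simp add: mult_mono_right imp_mp)
  also have "(x \<leadsto> y) \<otimes> (y \<leadsto> z) \<otimes> x = (y \<leadsto> z) \<otimes> ((x \<leadsto> y) \<otimes> x)"
    by (simp add: m_comm m_assoc m_lcomm)
  ultimately have "(x \<leadsto> y) \<otimes> (y \<leadsto> z) \<otimes> x \<preceq> z"
    using imp_mp [of y z] by (auto intro: le_trans [of _ "(y \<leadsto> z) \<otimes> y" z])
  then show ?thesis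
    by (simp add: residuation)
qed

text \<open>First of five bounds, ending with \<open>imp_imp_antimono\<close>, that make filter
  congruences compatible: any filter containing the left side also contains the implication on the
  right.\<close>

lemma imp_mult_mono:
  assumes [simp]: "x \<in> carrier L" "y \<in> carrier L" "z \<in> carrier L"
  shows "x \<leadsto> y \<preceq> x \<otimes> z \<leadsto> y \<otimes> z"
proof -
  have "(x \<leadsto> y) \<otimes> x \<otimes> z \<preceq> y \<otimes> z"
    by (simp add: mult_mono_left imp_mp)
  then show ?thesis
    by (simp flip: residuation add: m_assoc)
qed

lemma imp_meet_mono:
  assumes [simp]: "x \<in> carrier L" "y \<in> carrier L" "z \<in> carrier L"
  shows "x \<leadsto> y \<preceq> x \<curlywedge> z \<leadsto> y \<curlywedge> z"
proof -
  have "(x \<leadsto> y) \<otimes> (x \<curlywedge> z) \<preceq> (x \<leadsto> y) \<otimes> x"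
    by (simp add: mult_mono_right meet_le1)
  then have "(x \<leadsto> y) \<otimes> (x \<curlywedge> z) \<preceq> y"
    using imp_mp [of x y] by (auto intro: le_trans [of _ "(x \<leadsto> y) \<otimes> x" y])
  moreover have "(x \<leadsto> y) \<otimes> (x \<curlywedge> z) \<preceq> z"
    using mult_le2 [of "x \<leadsto> y" "x \<curlywedge> z"] meet_le2 [of x z]
    by (auto intro: le_trans [of _ "x \<curlywedge> z" z])
  ultimately show ?thesis
    by (simp flip: residuation add: le_meet)
qed

text \<open>Residuation is used with the roles of the factors exchanged, so that the join stands
  alone on the left and \<open>join_le\<close> treats \<open>x\<close> and \<open>z\<close>
  separately.\<close>

lemma imp_join_mono:
  assumes [simp]: "x \<in> carrier L" "y \<in> carrier L" "z \<in> carrier L"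
  shows "x \<leadsto> y \<preceq> x \<curlyvee> z \<leadsto> y \<curlyvee> z"
proof -
  let ?a = "x \<leadsto> y"
  have "x \<otimes> ?a \<preceq> y \<curlyvee> z"
    using imp_mp [of x y] le_join1 [of y z] m_comm [of x ?a]
    by (auto intro: le_trans [of _ y "y \<curlyvee> z"])
  moreover have "z \<otimes> ?a \<preceq> y \<curlyvee> z"
    using mult_le1 [of z ?a] le_join2 [of y z] by (auto intro: le_trans [of _ z "y \<curlyvee> z"])
  ultimately have "x \<curlyvee> z \<preceq> ?a \<leadsto> y \<curlyvee> z"
    by (simp add: residuation join_le)
  then show ?thesis
    by (simp flip: residuation add: m_comm)
qed

lemma imp_imp_mono:
  assumes [simp]: "x \<in> carrier L" "y \<in> carrier L" "z \<in> carrier L"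
  shows "x \<leadsto> y \<preceq> (z \<leadsto> x) \<leadsto> (z \<leadsto> y)"
  using imp_trans_le [of z x y] by (simp flip: residuation add: m_comm)

lemma imp_imp_antimono:
  assumes [simp]: "x \<in> carrier L" "y \<in> carrier L" "z \<in> carrier L"
  shows "x \<leadsto> y \<preceq> (y \<leadsto> z) \<leadsto> (x \<leadsto> z)"
  using imp_trans_le [of x y z] by (simp flip: residuation)

text \<open>Since \<open>rl_le\<close> is defined by meets, comparing classes in the quotient
  involves \<open>x \<leadsto> x \<curlywedge> y\<close>; this bound reduces it to
  \<open>x \<leadsto> y\<close>.\<close>

lemma imp_le_imp_meet:
  assumes [simp]: "x \<in> carrier L" "y \<in> carrier L"
  shows "x \<leadsto> y \<preceq> x \<leadsto> x \<curlywedge> y"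
  using imp_mp [of x y] mult_le2 [of "x \<leadsto> y" x]
  by (simp flip: residuation add: le_meet)

end

section \<open>The quotient by a filter\<close>

text \<open>
  On classes of a congruence, the image of the set of all products \<open>f x y\<close> under the congruence
  is the class of any one of them; this avoids choosing representatives.
\<close>

definition lift_op ::
    "('a, 'm) reslat_scheme \<Rightarrow> 'a set \<Rightarrow> ('a \<Rightarrow> 'a \<Rightarrow> 'a) \<Rightarrow> 'a set \<Rightarrow> 'a set \<Rightarrow> 'a set" where
  "lift_op L F f X Y = filter_cong L F `` {f x y |x y. x \<in> X \<and> y \<in> Y}"

definition rl_quotient :: "('a, 'm) reslat_scheme \<Rightarrow> 'a set \<Rightarrow> 'a set reslat" where
  "rl_quotient L F =
     \<lparr>carrier = (\<lambda>x. filter_class L x F) ` carrier L,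
      mult = lift_op L F (mult L),
      one = filter_class L \<one>\<^bsub>L\<^esub> F,
      rl_meet = lift_op L F (rl_meet L),
      rl_join = lift_op L F (rl_join L),
      rl_imp = lift_op L F (rl_imp L),
      rl_zero = filter_class L (rl_zero L) F\<rparr>"

locale reslat_filter = residuated_lattice +
  fixes F
  assumes filter: "rl_filter L F"
begin

section \<open>The congruence of a filter\<close>

lemma filter_subset: "F \<subseteq> carrier L"
  using filter by (simp add: rl_filter_def)

lemma filter_up: "\<lbrakk>x \<preceq> y; x \<in> F; y \<in> carrier L\<rbrakk> \<Longrightarrow> y \<in> F"
  using filter by (auto simp: rl_filter_def)

lemma filter_mult: "\<lbrakk>x \<in> F; y \<in> F\<rbrakk> \<Longrightarrow> x \<otimes> y \<in> F"
  using filter by (auto simp: rl_filter_def)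

lemma one_in_filter: "\<one> \<in> F"
proof -
  obtain x where "x \<in> F"
    using filter by (auto simp: rl_filter_def)
  then show ?thesis
    using filter_up [OF le_one, of x] filter_subset by auto
qed

text \<open>A product lies below both factors. This splits the single product in
  \<open>filter_cong\<close> into two implications.\<close>

lemma filter_mult_iff:
  "\<lbrakk>x \<in> carrier L; y \<in> carrier L\<rbrakk> \<Longrightarrow> x \<otimes> y \<in> F \<longleftrightarrow> x \<in> F \<and> y \<in> F"
  using filter_mult filter_up [OF mult_le1] filter_up [OF mult_le2] by blast

lemma cong_iff:
  "(x, y) \<in> filter_cong L F \<longleftrightarrow>
     x \<in> carrier L \<and> y \<in> carrier L \<and> x \<leadsto> y \<in> F \<and> y \<leadsto> x \<in> F"
  by (auto simp: filter_cong_def filter_mult_iff)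

lemma imp_in_filter_trans:
  assumes "x \<leadsto> y \<in> F" "y \<leadsto> z \<in> F" "x \<in> carrier L" "y \<in> carrier L" "z \<in> carrier L"
  shows "x \<leadsto> z \<in> F"
  by (rule filter_up [OF imp_trans_le filter_mult [OF assms(1,2)]]) (use assms(3-5) in simp_all)

lemma imp_self_in_filter: "x \<in> carrier L \<Longrightarrow> x \<leadsto> x \<in> F"
  by (metis imp_eq_one_iff le_refl one_in_filter)

lemma equiv_cong: "equiv (carrier L) (filter_cong L F)"
proof (rule equivI)
  show "trans (filter_cong L F)"
    unfolding trans_def cong_iff using imp_in_filter_trans by blast
qed (auto simp: refl_on_def sym_def cong_iff imp_self_in_filter)

lemma class_eq_iff:
  "\<lbrakk>x \<in> carrier L; y \<in> carrier L\<rbrakk> \<Longrightarrow>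
     filter_class L x F = filter_class L y F \<longleftrightarrow> x \<leadsto> y \<in> F \<and> y \<leadsto> x \<in> F"
  unfolding filter_class_def by (simp add: eq_equiv_class_iff [OF equiv_cong] cong_iff)

lemma in_class_iff:
  "x \<in> carrier L \<Longrightarrow>
     y \<in> filter_class L x F \<longleftrightarrow> y \<in> carrier L \<and> filter_class L x F = filter_class L y F"
  unfolding filter_class_def
  using eq_equiv_class_iff [OF equiv_cong] by (auto simp: cong_iff)

text \<open>One argument is replaced at a time, and the two replacements are chained by
  transitivity. \<open>cong_meet\<close>, \<open>cong_join\<close> and \<open>cong_imp\<close>
  follow the same pattern.\<close>

lemma cong_mult:
  assumes "(x, x') \<in> filter_cong L F" "(y, y') \<in> filter_cong L F"
  shows "(x \<otimes> y, x' \<otimes> y') \<in> filter_cong L F"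
proof -
  have "u \<otimes> w \<leadsto> v \<otimes> w \<in> F" "w \<otimes> u \<leadsto> w \<otimes> v \<in> F"
    if "u \<leadsto> v \<in> F" "u \<in> carrier L" "v \<in> carrier L" "w \<in> carrier L" for u v w
    using that imp_mult_mono [of u v w] by (auto intro: filter_up simp: m_comm)
  then show ?thesis
    using assms unfolding cong_iff
    by (meson imp_in_filter_trans m_closed)
qed

lemma cong_meet:
  assumes "(x, x') \<in> filter_cong L F" "(y, y') \<in> filter_cong L F"
  shows "(x \<curlywedge> y, x' \<curlywedge> y') \<in> filter_cong L F"
proof -
  have "u \<curlywedge> w \<leadsto> v \<curlywedge> w \<in> F" "w \<curlywedge> u \<leadsto> w \<curlywedge> v \<in> F"
    if "u \<leadsto> v \<in> F" "u \<in> carrier L" "v \<in> carrier L" "w \<in> carrier L" for u v w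
    using that imp_meet_mono [of u v w] by (auto intro: filter_up simp: meet_comm)
  then show ?thesis
    using assms unfolding cong_iff
    by (meson imp_in_filter_trans meet_closed)
qed

lemma cong_join:
  assumes "(x, x') \<in> filter_cong L F" "(y, y') \<in> filter_cong L F"
  shows "(x \<curlyvee> y, x' \<curlyvee> y') \<in> filter_cong L F"
proof -
  have "u \<curlyvee> w \<leadsto> v \<curlyvee> w \<in> F" "w \<curlyvee> u \<leadsto> w \<curlyvee> v \<in> F"
    if "u \<leadsto> v \<in> F" "u \<in> carrier L" "v \<in> carrier L" "w \<in> carrier L" for u v w
    using that imp_join_mono [of u v w] by (auto intro: filter_up simp: join_comm)
  then show ?thesis
    using assms unfolding cong_iff
    by (meson imp_in_filter_trans join_closed)
qed

lemma cong_imp: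
  assumes "(x, x') \<in> filter_cong L F" "(y, y') \<in> filter_cong L F"
  shows "(x \<leadsto> y, x' \<leadsto> y') \<in> filter_cong L F"
proof -
  \<comment> \<open>Implication reverses direction in its first argument; this is harmless because
    \<open>cong_iff\<close> supplies both directions.\<close>
  have "(v \<leadsto> w) \<leadsto> (u \<leadsto> w) \<in> F" "(w \<leadsto> u) \<leadsto> (w \<leadsto> v) \<in> F"
    if "u \<leadsto> v \<in> F" "u \<in> carrier L" "v \<in> carrier L" "w \<in> carrier L" for u v w
    using that imp_imp_mono [of u v w] imp_imp_antimono [of u v w] by (auto intro: filter_up)
  then show ?thesis
    using assms unfolding cong_iff
    by (meson imp_in_filter_trans imp_closed)
qed

lemma lift_op_class:
  assumes "\<And>x x' y y'. \<lbrakk>(x, x') \<in> filter_cong L F; (y, y') \<in> filter_cong L F\<rbrakk>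
             \<Longrightarrow> (f x y, f x' y') \<in> filter_cong L F"
    and "x \<in> carrier L" "y \<in> carrier L"
  shows "lift_op L F f (filter_class L x F) (filter_class L y F) = filter_class L (f x y) F"
proof -
  have eq: "filter_cong L F `` {f x' y'} = filter_cong L F `` {f x y}"
    if "(x, x') \<in> filter_cong L F" "(y, y') \<in> filter_cong L F" for x' y'
    using assms(1) [OF that] equiv_class_eq [OF equiv_cong] by metis
  \<comment> \<open>By \<open>eq\<close> all values on representatives have one common class;
    reflexivity guarantees that there are representatives at all, so the image is that class and not
    empty.\<close>
  have "(x, x) \<in> filter_cong L F" "(y, y) \<in> filter_cong L F"
    using assms by (auto simp: cong_iff imp_self_in_filter)
  then show ?thesis
    unfolding lift_op_def filter_class_def using eq by blast
qed

section \<open>The quotient algebra and maps between quotients\<close>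

lemma quotient_carrier: "carrier (rl_quotient L F) = (\<lambda>x. filter_class L x F) ` carrier L"
  by (simp add: rl_quotient_def)

lemma quotient_ops:
  "\<one>\<^bsub>rl_quotient L F\<^esub> = filter_class L \<one> F"
  "rl_zero (rl_quotient L F) = filter_class L (rl_zero L) F"
  "\<lbrakk>x \<in> carrier L; y \<in> carrier L\<rbrakk> \<Longrightarrow>
     filter_class L x F \<otimes>\<^bsub>rl_quotient L F\<^esub> filter_class L y F = filter_class L (x \<otimes> y) F"
  "\<lbrakk>x \<in> carrier L; y \<in> carrier L\<rbrakk> \<Longrightarrow>
     filter_class L x F \<curlywedge>\<^bsub>rl_quotient L F\<^esub> filter_class L y F = filter_class L (x \<curlywedge> y) F"
  "\<lbrakk>x \<in> carrier L; y \<in> carrier L\<rbrakk> \<Longrightarrow>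
     filter_class L x F \<curlyvee>\<^bsub>rl_quotient L F\<^esub> filter_class L y F = filter_class L (x \<curlyvee> y) F"
  "\<lbrakk>x \<in> carrier L; y \<in> carrier L\<rbrakk> \<Longrightarrow>
     filter_class L x F \<leadsto>\<^bsub>rl_quotient L F\<^esub> filter_class L y F = filter_class L (x \<leadsto> y) F"
  by (simp_all add: rl_quotient_def lift_op_class cong_mult cong_meet cong_join cong_imp)

text \<open>The order of the quotient says that \<open>x \<curlywedge> y\<close> and
  \<open>x\<close> are congruent. One of the two implications is always \<open>\<one>\<close>; the
  other is in \<open>F\<close> exactly when \<open>x \<leadsto> y\<close> is.\<close>

lemma quotient_le_iff:
  assumes [simp]: "x \<in> carrier L" "y \<in> carrier L"
  shows "rl_le (rl_quotient L F) (filter_class L x F) (filter_class L y F) \<longleftrightarrow> x \<leadsto> y \<in> F"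
proof -
  have "x \<curlywedge> y \<leadsto> x \<in> F"
    by (metis assms imp_eq_one_iff meet_closed meet_le1 one_in_filter)
  moreover have "x \<leadsto> x \<curlywedge> y \<in> F \<longleftrightarrow> x \<leadsto> y \<in> F"
  proof
    have "x \<curlywedge> y \<leadsto> y \<in> F"
      by (metis assms imp_eq_one_iff meet_closed meet_le2 one_in_filter)
    then show "x \<leadsto> x \<curlywedge> y \<in> F \<Longrightarrow> x \<leadsto> y \<in> F"
      using imp_in_filter_trans by simp
  qed (rule filter_up [OF imp_le_imp_meet], simp_all)
  ultimately show ?thesis
    by (simp add: rl_le_def quotient_ops class_eq_iff)
qed

lemma residuated_lattice_quotient: "residuated_lattice (rl_quotient L F)"
proof
  have "filter_class L x F \<in> carrier (rl_quotient L F)" if "x \<in> carrier L" for x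
    using that by (simp add: quotient_carrier)
  note simps = this quotient_ops quotient_le_iff
  have le1: "x \<leadsto> y \<in> F" if "x \<preceq> y" "x \<in> carrier L" "y \<in> carrier L" for x y
    using that by (metis imp_eq_one_iff one_in_filter)
  fix X Y Z
  let ?Q = "carrier (rl_quotient L F)"
  show "\<one>\<^bsub>rl_quotient L F\<^esub> \<in> ?Q" "rl_zero (rl_quotient L F) \<in> ?Q"
    by (simp_all add: simps)
  assume "X \<in> ?Q"
  then obtain x where x [simp]: "x \<in> carrier L" "X = filter_class L x F"
    by (auto simp: quotient_carrier)
  show "\<one>\<^bsub>rl_quotient L F\<^esub> \<otimes>\<^bsub>rl_quotient L F\<^esub> X = X" "X \<otimes>\<^bsub>rl_quotient L F\<^esub> \<one>\<^bsub>rl_quotient L F\<^esub> = X"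
    "rl_le (rl_quotient L F) (rl_zero (rl_quotient L F)) X"
    "rl_le (rl_quotient L F) X \<one>\<^bsub>rl_quotient L F\<^esub>"
    by (simp_all add: simps le1 zero_le le_one)
  assume "Y \<in> ?Q"
  then obtain y where y [simp]: "y \<in> carrier L" "Y = filter_class L y F"
    by (auto simp: quotient_carrier)
  show "X \<otimes>\<^bsub>rl_quotient L F\<^esub> Y \<in> ?Q" "X \<curlywedge>\<^bsub>rl_quotient L F\<^esub> Y \<in> ?Q"
    "X \<curlyvee>\<^bsub>rl_quotient L F\<^esub> Y \<in> ?Q" "X \<leadsto>\<^bsub>rl_quotient L F\<^esub> Y \<in> ?Q"
    by (simp_all add: simps)
  show "X \<otimes>\<^bsub>rl_quotient L F\<^esub> Y = Y \<otimes>\<^bsub>rl_quotient L F\<^esub> X"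
    by (simp add: simps m_comm)
  show "X \<curlywedge>\<^bsub>rl_quotient L F\<^esub> Y = Y \<curlywedge>\<^bsub>rl_quotient L F\<^esub> X"
    by (simp add: simps meet_comm)
  show "X \<curlyvee>\<^bsub>rl_quotient L F\<^esub> Y = Y \<curlyvee>\<^bsub>rl_quotient L F\<^esub> X"
    by (simp add: simps join_comm)
  show "X \<curlywedge>\<^bsub>rl_quotient L F\<^esub> (X \<curlyvee>\<^bsub>rl_quotient L F\<^esub> Y) = X"
    "X \<curlyvee>\<^bsub>rl_quotient L F\<^esub> (X \<curlywedge>\<^bsub>rl_quotient L F\<^esub> Y) = X"
    by (simp_all add: simps meet_absorb join_absorb)
  assume "Z \<in> ?Q"
  then obtain z where z [simp]: "z \<in> carrier L" "Z = filter_class L z F"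
    by (auto simp: quotient_carrier)
  show "X \<otimes>\<^bsub>rl_quotient L F\<^esub> Y \<otimes>\<^bsub>rl_quotient L F\<^esub> Z = X \<otimes>\<^bsub>rl_quotient L F\<^esub> (Y \<otimes>\<^bsub>rl_quotient L F\<^esub> Z)"
    by (simp add: simps m_assoc)
  show "X \<curlywedge>\<^bsub>rl_quotient L F\<^esub> Y \<curlywedge>\<^bsub>rl_quotient L F\<^esub> Z = X \<curlywedge>\<^bsub>rl_quotient L F\<^esub> (Y \<curlywedge>\<^bsub>rl_quotient L F\<^esub> Z)"
    by (simp add: simps meet_assoc)
  show "X \<curlyvee>\<^bsub>rl_quotient L F\<^esub> Y \<curlyvee>\<^bsub>rl_quotient L F\<^esub> Z = X \<curlyvee>\<^bsub>rl_quotient L F\<^esub> (Y \<curlyvee>\<^bsub>rl_quotient L F\<^esub> Z)"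
    by (simp add: simps join_assoc)
  \<comment> \<open>By \<open>quotient_le_iff\<close> both sides are membership in \<open>F\<close>
    of elements that currying identifies.\<close>
  show "rl_le (rl_quotient L F) (X \<otimes>\<^bsub>rl_quotient L F\<^esub> Y) Z
      \<longleftrightarrow> rl_le (rl_quotient L F) X (Y \<leadsto>\<^bsub>rl_quotient L F\<^esub> Z)"
    by (simp add: simps imp_mult)
qed

text \<open>An \<open>F\<close>-class lies inside a single \<open>G\<close>-class, so the image
  under the coarser congruence is the canonical map between quotients, free of
  representatives.\<close>

lemma cong_Image_class:
  assumes "rl_filter L G" "F \<subseteq> G" "x \<in> carrier L"
  shows "filter_cong L G `` filter_class L x F = filter_class L x G"
proof -
  interpret G: reslat_filter L G
    using assms by unfold_locales
  have "filter_cong L F \<subseteq> filter_cong L G"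
    using assms by (auto simp: filter_cong_def)
  moreover have "(x, x) \<in> filter_cong L F"
    using assms by (simp add: cong_iff imp_self_in_filter)
  ultimately show ?thesis
    unfolding filter_class_def
    using G.equiv_cong by (blast dest: equivE symD transD)
qed

lemma quotient_map_hom:
  assumes G: "rl_filter L G" and FG: "F \<subseteq> G"
  shows "(\<lambda>X. filter_cong L G `` X) \<in> rl_hom (rl_quotient L F) (rl_quotient L G)"
proof -
  interpret G: reslat_filter L G
    using assms by unfold_locales
  show ?thesis
    unfolding rl_hom_def hom_def
    by (auto simp: quotient_carrier G.quotient_carrier quotient_ops G.quotient_ops
        cong_Image_class [OF G FG])
qed

end

section \<open>Kernels and clopen filters\<close>

lemma rl_hom_comp:
  assumes "f \<in> rl_hom L M" "g \<in> rl_hom M N"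
  shows "(\<lambda>x. g (f x)) \<in> rl_hom L N"
  using assms unfolding rl_hom_def hom_def by (auto simp: Pi_iff)

text \<open>For upward closure, \<open>x \<preceq> y\<close> and \<open>f x = \<one>\<close> give
  that \<open>\<one>\<close> is the meet of \<open>\<one>\<close> and \<open>f y\<close>, and
  nothing else lies above the top.\<close>

lemma rl_filter_kernel:
  assumes "residuated_lattice L" "residuated_lattice M" and f: "f \<in> rl_hom L M"
  shows "rl_filter L {x \<in> carrier L. f x = \<one>\<^bsub>M\<^esub>}"
proof -
  interpret L: residuated_lattice L by fact
  interpret M: residuated_lattice M by fact
  have f_one: "f \<one>\<^bsub>L\<^esub> = \<one>\<^bsub>M\<^esub>"
    and f_mult: "\<And>x y. \<lbrakk>x \<in> carrier L; y \<in> carrier L\<rbrakk> \<Longrightarrow> f (x \<otimes>\<^bsub>L\<^esub> y) = f x \<otimes>\<^bsub>M\<^esub> f y"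
    and f_meet: "\<And>x y. \<lbrakk>x \<in> carrier L; y \<in> carrier L\<rbrakk> \<Longrightarrow> f (x \<curlywedge>\<^bsub>L\<^esub> y) = f x \<curlywedge>\<^bsub>M\<^esub> f y"
    and f_closed: "\<And>x. x \<in> carrier L \<Longrightarrow> f x \<in> carrier M"
    using f by (auto simp: rl_hom_def hom_def)
  have up: "f y = \<one>\<^bsub>M\<^esub>" if "x \<in> carrier L" "y \<in> carrier L" "f x = \<one>\<^bsub>M\<^esub>" "rl_le L x y" for x y
    using that f_meet [of x y] f_closed [of y] M.one_le_iff [of "f y"] by (simp add: rl_le_def)
  show ?thesis
    unfolding rl_filter_def
  proof (intro conjI ballI impI)
    show "{x \<in> carrier L. f x = \<one>\<^bsub>M\<^esub>} \<noteq> {}"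
      using f_one by blast
  next
    fix x y
    assume x: "x \<in> {x \<in> carrier L. f x = \<one>\<^bsub>M\<^esub>}"
    show "x \<otimes>\<^bsub>L\<^esub> y \<in> {x \<in> carrier L. f x = \<one>\<^bsub>M\<^esub>}"
      if "y \<in> {x \<in> carrier L. f x = \<one>\<^bsub>M\<^esub>}"
      using x that by (simp add: f_mult)
    show "y \<in> {x \<in> carrier L. f x = \<one>\<^bsub>M\<^esub>}" if "y \<in> carrier L" "rl_le L x y"
      using x that up [of x y] by simp
  qed simp
qed

text \<open>Congruence modulo the kernel makes both implications between \<open>f x\<close> and
  \<open>f y\<close> equal to \<open>\<one>\<close>, hence each lies below the other.\<close>

lemma kernel_class_eq_imp:
  assumes "residuated_lattice L" "residuated_lattice M" and f: "f \<in> rl_hom L M"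
    and [simp]: "x \<in> carrier L" "y \<in> carrier L"
    and eq: "filter_class L x {x \<in> carrier L. f x = \<one>\<^bsub>M\<^esub>} =
             filter_class L y {x \<in> carrier L. f x = \<one>\<^bsub>M\<^esub>}"
  shows "f x = f y"
proof -
  interpret M: residuated_lattice M by fact
  interpret K: reslat_filter L "{x \<in> carrier L. f x = \<one>\<^bsub>M\<^esub>}"
    using assms rl_filter_kernel by (simp add: reslat_filter_def reslat_filter_axioms_def)
  have "f x \<in> carrier M" "f y \<in> carrier M"
    and "f (x \<leadsto>\<^bsub>L\<^esub> y) = f x \<leadsto>\<^bsub>M\<^esub> f y" "f (y \<leadsto>\<^bsub>L\<^esub> x) = f y \<leadsto>\<^bsub>M\<^esub> f x"
    using f by (auto simp: rl_hom_def hom_def)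
  then show ?thesis
    using eq by (simp add: K.class_eq_iff M.imp_eq_one_iff M.le_antisym)
qed

section \<open>Quotients by clopen filters\<close>

locale clopen_filter = reslat_filter +
  fixes \<tau>
  assumes topological: "topological_residuated_lattice L \<tau>"
    and filter_open: "openin \<tau> F" and filter_closed: "closedin \<tau> F"
begin

lemma topspace_eq: "topspace \<tau> = carrier L"
  using topological by (simp add: topological_residuated_lattice_def)

text \<open>The class is the preimage of \<open>F\<close> under the continuous map
  \<open>y \<mapsto> (x \<leadsto> y) \<otimes> (y \<leadsto> x)\<close>.\<close>

lemma clopen_class:
  assumes x: "x \<in> carrier L"
  shows "openin \<tau> (filter_class L x F)" "closedin \<tau> (filter_class L x F)"
proof -
  have mult: "continuous_map (prod_topology \<tau> \<tau>) \<tau> (\<lambda>(x, y). x \<otimes> y)"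
    and imp: "continuous_map (prod_topology \<tau> \<tau>) \<tau> (\<lambda>(x, y). x \<leadsto> y)"
    using topological by (simp_all add: topological_residuated_lattice_def)
  have "continuous_map \<tau> (prod_topology \<tau> \<tau>) (\<lambda>y. (x, y))"
    "continuous_map \<tau> (prod_topology \<tau> \<tau>) (\<lambda>y. (y, x))"
    using x by (auto simp: continuous_map_pairwise o_def topspace_eq)
  then have "continuous_map \<tau> \<tau> (\<lambda>y. x \<leadsto> y)" "continuous_map \<tau> \<tau> (\<lambda>y. y \<leadsto> x)"
    using continuous_map_compose [OF _ imp] by (force simp: o_def)+
  then have "continuous_map \<tau> (prod_topology \<tau> \<tau>) (\<lambda>y. (x \<leadsto> y, y \<leadsto> x))"
    by (simp add: continuous_map_pairwise o_def)
  then have cont: "continuous_map \<tau> \<tau> (\<lambda>y. (x \<leadsto> y) \<otimes> (y \<leadsto> x))"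
    using continuous_map_compose [OF _ mult] by (force simp: o_def)
  have "filter_class L x F = {y \<in> topspace \<tau>. (x \<leadsto> y) \<otimes> (y \<leadsto> x) \<in> F}"
    using x by (auto simp: filter_class_def filter_cong_def topspace_eq)
  then show "openin \<tau> (filter_class L x F)" "closedin \<tau> (filter_class L x F)"
    using openin_continuous_map_preimage [OF cont filter_open]
      closedin_continuous_map_preimage [OF cont filter_closed] by simp_all
qed

text \<open>The classes form an open cover by pairwise disjoint nonempty sets, so a finite subcover
  must contain all of them.\<close>

lemma finite_quotient:
  assumes "compact_space \<tau>"
  shows "finite (carrier (rl_quotient L F))"
proof -
  let ?C = "carrier (rl_quotient L F)"
  have "topspace \<tau> \<subseteq> \<Union>?C"
    by (auto simp: topspace_eq quotient_carrier in_class_iff)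
  moreover have "\<forall>U\<in>?C. openin \<tau> U"
    by (auto simp: quotient_carrier clopen_class)
  ultimately obtain D where D: "finite D" "D \<subseteq> ?C" "topspace \<tau> \<subseteq> \<Union>D"
    using assms unfolding compact_space_alt by meson
  have "?C \<subseteq> D"
  proof
    fix X assume "X \<in> ?C"
    then obtain x where x: "x \<in> carrier L" "X = filter_class L x F"
      by (auto simp: quotient_carrier)
    then obtain Y where "Y \<in> D" "x \<in> Y"
      using D topspace_eq by blast
    then show "X \<in> D"
      using D x by (auto simp: quotient_carrier in_class_iff)
  qed
  then show ?thesis
    using D finite_subset by blast
qed

text \<open>The preimage of any set of classes is a union of classes, each of them open.\<close>

lemma continuous_class_map:
  "continuous_map \<tau> (discrete_topology (carrier (rl_quotient L F))) (\<lambda>x. filter_class L x F)"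
proof -
  have "openin \<tau> {x \<in> topspace \<tau>. filter_class L x F \<in> U}" for U
  proof (subst openin_subopen, intro ballI)
    fix x assume "x \<in> {x \<in> topspace \<tau>. filter_class L x F \<in> U}"
    then show "\<exists>T. openin \<tau> T \<and> x \<in> T \<and> T \<subseteq> {x \<in> topspace \<tau>. filter_class L x F \<in> U}"
      using clopen_class by (intro exI [of _ "filter_class L x F"]) (auto simp: topspace_eq in_class_iff)
  qed
  then show ?thesis
    by (auto simp: continuous_map quotient_carrier topspace_eq)
qed

end

section \<open>From an inverse limit to clopen filters\<close>

lemma profinite_over_imp_clopen_filters:
  assumes top: "topological_residuated_lattice L \<tau>"
    and prof: "profinite_over TYPE('i) TYPE('b) L \<tau>"
  shows "\<exists>S. (\<forall>F\<in>S. rl_filter L F \<and> openin \<tau> F \<and> closedin \<tau> F) \<and>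
             (\<forall>F\<in>S. \<forall>G\<in>S. \<exists>H\<in>S. H \<subseteq> F \<inter> G) \<and>
             (\<forall>x\<in>carrier L. \<forall>y\<in>carrier L. x \<noteq> y \<longrightarrow>
                (\<exists>F\<in>S. filter_class L x F \<noteq> filter_class L y F))"
proof -
  obtain I r and A :: "'i \<Rightarrow> 'b reslat" and p
    where sys: "inverse_system I r A p"
      and iso: "topologically_isomorphic L \<tau> (inverse_limit I r A p) (inverse_limit_topology I r A p)"
    using prof unfolding profinite_over_def by blast
  let ?M = "inverse_limit I r A p"
  obtain h where h: "h \<in> rl_hom L ?M" "bij_betw h (carrier L) (carrier ?M)"
    and homeo: "homeomorphic_map \<tau> (inverse_limit_topology I r A p) h"
    using iso unfolding topologically_isomorphic_def by blast
  have L: "residuated_lattice L" and ts: "topspace \<tau> = carrier L"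
    using top by (simp_all add: topological_residuated_lattice_def)
  have A: "residuated_lattice (A i)" if "i \<in> I" for i
    using sys that by (simp add: inverse_system_def)
  have p: "p i j \<in> rl_hom (A i) (A j)" if "(j, i) \<in> r" for i j
    using sys that by (auto simp: inverse_system_def)
  have "(\<lambda>b. b i) \<in> rl_hom ?M (A i)" if "i \<in> I" for i
    using that by (auto simp: rl_hom_def hom_def inverse_limit_def)
  then have proj: "(\<lambda>x. h x i) \<in> rl_hom L (A i)" if "i \<in> I" for i
    using that rl_hom_comp [OF h(1)] by blast
  have h_in: "h x \<in> carrier ?M" if "x \<in> carrier L" for x
    using h(2) that by (auto simp: bij_betw_def)
  have cont: "continuous_map \<tau> (discrete_topology (carrier (A i))) (\<lambda>x. h x i)" if "i \<in> I" for i
    using homeomorphic_imp_continuous_map [OF homeo] that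
    unfolding inverse_limit_topology_def continuous_map_in_subtopology continuous_map_componentwise
    by simp
  let ?K = "\<lambda>i. {x \<in> carrier L. h x i = \<one>\<^bsub>A i\<^esub>}"
  have clopen: "rl_filter L (?K i) \<and> openin \<tau> (?K i) \<and> closedin \<tau> (?K i)" if "i \<in> I" for i
  proof -
    interpret A: residuated_lattice "A i"
      using A that .
    \<comment> \<open>Singletons are clopen in the discrete factor, and the coordinate map is
      continuous.\<close>
    have "?K i = {x \<in> topspace \<tau>. h x i \<in> {\<one>\<^bsub>A i\<^esub>}}"
      by (simp add: ts)
    then have "openin \<tau> (?K i)" "closedin \<tau> (?K i)"
      using openin_continuous_map_preimage [OF cont [OF that], of "{\<one>\<^bsub>A i\<^esub>}"]
        closedin_continuous_map_preimage [OF cont [OF that], of "{\<one>\<^bsub>A i\<^esub>}"] by simp_all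
    then show ?thesis
      using rl_filter_kernel [OF L A proj] that by simp
  qed
  have directed: "\<exists>k\<in>I. ?K k \<subseteq> ?K i \<inter> ?K j" if "i \<in> I" "j \<in> I" for i j
  proof -
    obtain k where k: "k \<in> I" "(i, k) \<in> r" "(j, k) \<in> r"
      using sys \<open>i \<in> I\<close> \<open>j \<in> I\<close> unfolding inverse_system_def directed_poset_def by blast
    \<comment> \<open>To be used for \<open>l = i\<close> and \<open>l = j\<close>: the connecting
      map from the common upper bound \<open>k\<close> preserves the unit.\<close>
    have "h x l = \<one>\<^bsub>A l\<^esub>" if "x \<in> ?K k" "(l, k) \<in> r" for x l
    proof -
      have "h x l = p k l (h x k)"
        using that h_in [of x] by (auto simp: inverse_limit_def)
      also have "\<dots> = \<one>\<^bsub>A l\<^esub>"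
        using that p [of l k] by (simp add: rl_hom_def)
      finally show ?thesis .
    qed
    then show ?thesis
      using k by (intro bexI [of _ k]) auto
  qed
  have separating: "\<exists>i\<in>I. filter_class L x (?K i) \<noteq> filter_class L y (?K i)"
    if xy: "x \<in> carrier L" "y \<in> carrier L" "x \<noteq> y" for x y
  proof (rule ccontr)
    assume "\<not> ?thesis"
    then have "h x i = h y i" if "i \<in> I" for i
      using kernel_class_eq_imp [OF L A proj xy(1,2), of i] that by blast
    \<comment> \<open>Elements of the limit are fixed outside \<open>I\<close>, so agreement on
      \<open>I\<close> is equality.\<close>
    moreover have "h x \<in> extensional I" "h y \<in> extensional I"
      using h_in xy by (auto simp: inverse_limit_def PiE_def)
    ultimately have "h x = h y"
      by (metis extensionalityI)
    then show False
      using h(2) xy by (auto simp: bij_betw_def inj_on_def)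
  qed
  show ?thesis
    using clopen directed separating by (intro exI [of _ "?K ` I"]) (simp add: image_iff)
qed

section \<open>From clopen filters to an inverse limit\<close>

lemma clopen_filters_imp_profinite:
  fixes L :: "('a, 'm) reslat_scheme"
  assumes top: "topological_residuated_lattice L \<tau>" and comp: "compact_space \<tau>"
    and clopen: "\<And>F. F \<in> S \<Longrightarrow> rl_filter L F \<and> openin \<tau> F \<and> closedin \<tau> F"
    and directed: "\<And>F G. \<lbrakk>F \<in> S; G \<in> S\<rbrakk> \<Longrightarrow> \<exists>H\<in>S. H \<subseteq> F \<inter> G"
    and separating: "\<And>x y. \<lbrakk>x \<in> carrier L; y \<in> carrier L; x \<noteq> y\<rbrakk> \<Longrightarrow>
                       \<exists>F\<in>S. filter_class L x F \<noteq> filter_class L y F"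
    and nonempty: "S \<noteq> {}"
  shows "profinite L \<tau>"
proof -
  interpret residuated_lattice L
    using top by (simp add: topological_residuated_lattice_def)
  have clopen_filter: "clopen_filter L F \<tau>" if "F \<in> S" for F
    using clopen [OF that] top by unfold_locales auto
  have rf: "reslat_filter L F" if "F \<in> S" for F
    using clopen_filter [OF that] by (simp add: clopen_filter_def)
  have ts: "topspace \<tau> = carrier L"
    using top by (simp add: topological_residuated_lattice_def)
  \<comment> \<open>The order is reverse inclusion: a smaller filter has a larger index and a finer
    quotient, and \<open>p F G\<close> coarsens \<open>F\<close>-classes to
    \<open>G\<close>-classes.\<close>
  define r where "r = {(G, F). F \<in> S \<and> G \<in> S \<and> F \<subseteq> G}"
  define p where "p = (\<lambda>(F :: 'a set) G. (``) (filter_cong L G))"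
  \<comment> \<open>Every element of a quotient is a class, so the laws of the inverse system all
    reduce to this formula.\<close>
  have p_class: "p F G (filter_class L x F) = filter_class L x G"
    if "(G, F) \<in> r" "x \<in> carrier L" for F G x
    using that clopen rf reslat_filter.cong_Image_class by (fastforce simp: r_def p_def)
  have sys: "inverse_system S r (rl_quotient L) p"
    unfolding inverse_system_def
  proof (intro conjI ballI allI impI)
    have "partial_order_on S r"
      by (auto simp: partial_order_on_def preorder_on_def refl_on_def trans_def antisym_def r_def)
    moreover have "\<exists>H\<in>S. (F, H) \<in> r \<and> (G, H) \<in> r" if "F \<in> S" "G \<in> S" for F G
      using directed [OF that] that by (auto simp: r_def)
    ultimately show "directed_poset S r"
      using nonempty by (simp add: directed_poset_def)
  next
    fix F assume "F \<in> S"
    then show "residuated_lattice (rl_quotient L F)"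
      using rf reslat_filter.residuated_lattice_quotient by blast
  next
    fix u assume "u \<in> r"
    then obtain F G where u: "u = (G, F)" "F \<in> S" "G \<in> S" "F \<subseteq> G"
      by (auto simp: r_def)
    then show "case u of (G, F) \<Rightarrow> p F G \<in> rl_hom (rl_quotient L F) (rl_quotient L G)"
      using reslat_filter.quotient_map_hom [OF rf] clopen by (simp add: p_def)
  next
    fix F X assume "F \<in> S" "X \<in> carrier (rl_quotient L F)"
    then show "p F F X = X"
      using reslat_filter.quotient_carrier [OF rf] p_class [of F F] by (auto simp: r_def)
  next
    fix F G H X
    assume "F \<in> S" "G \<in> S" "H \<in> S" "(H, G) \<in> r" "(G, F) \<in> r" "X \<in> carrier (rl_quotient L F)"
    moreover then have "(H, F) \<in> r"
      by (auto simp: r_def)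
    ultimately show "p G H (p F G X) = p F H X"
      using reslat_filter.quotient_carrier [OF rf] p_class by auto
  qed
  have fin: "\<forall>F\<in>S. finite (carrier (rl_quotient L F))"
    using clopen_filter.finite_quotient [OF clopen_filter comp] by blast
  let ?M = "inverse_limit S r (rl_quotient L) p"
  let ?T = "inverse_limit_topology S r (rl_quotient L) p"
  define h where "h = (\<lambda>x. \<lambda>F\<in>S. filter_class L x F)"
  have r_S: "F \<in> S \<and> G \<in> S" if "(G, F) \<in> r" for F G
    using that by (simp add: r_def)
  have carrier_M: "carrier ?M =
      {b \<in> \<Pi>\<^sub>E F\<in>S. carrier (rl_quotient L F). \<forall>(G, F)\<in>r. p F G (b F) = b G}"
    by (simp add: inverse_limit_def)
  have h_in: "h x \<in> carrier ?M" if "x \<in> carrier L" for x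
    using that r_S p_class reslat_filter.quotient_carrier [OF rf]
    by (auto simp: carrier_M h_def)
  have hom: "h \<in> rl_hom L ?M"
    unfolding rl_hom_def hom_def
    using h_in
    by (auto simp: h_def inverse_limit_def fun_eq_iff reslat_filter.quotient_ops [OF rf])
  have inj: "inj_on h (carrier L)"
  proof (rule inj_onI, rule ccontr)
    fix x y assume "x \<in> carrier L" "y \<in> carrier L" "h x = h y" "x \<noteq> y"
    then show False
      using separating [of x y] by (metis h_def restrict_apply')
  qed
  have surj: "b \<in> h ` carrier L" if b: "b \<in> carrier ?M" for b
  proof -
    have bF: "b F \<in> (\<lambda>x. filter_class L x F) ` carrier L" if "F \<in> S" for F
      using b that reslat_filter.quotient_carrier [OF rf [OF that]] by (auto simp: carrier_M)
    \<comment> \<open>Compatibility forces one representative to serve both: if \<open>b F\<close>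
      is the class of \<open>x\<close> modulo \<open>F\<close>, then \<open>b G\<close> is its class
      modulo the larger \<open>G\<close>.\<close>
    have b_mono: "b F \<subseteq> b G" if "F \<in> S" "G \<in> S" "F \<subseteq> G" for F G
    proof -
      have "(G, F) \<in> r"
        using that by (simp add: r_def)
      then have "p F G (b F) = b G"
        using b by (auto simp: carrier_M)
      moreover obtain x where x: "x \<in> carrier L" "b F = filter_class L x F"
        using bF \<open>F \<in> S\<close> by blast
      moreover have "filter_class L x F \<subseteq> filter_class L x G"
        using that by (auto simp: filter_class_def filter_cong_def)
      ultimately show ?thesis
        using p_class [of G F x] that by (simp add: r_def)
    qed
    \<comment> \<open>Directedness extended from pairs to finite subsets; the empty subset relies on
      \<open>nonempty\<close>.\<close>
    have lower: "\<exists>H\<in>S. \<forall>F\<in>E. H \<subseteq> F" if "finite E" "E \<subseteq> S" for E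
      using that
    proof induction
      case empty
      then show ?case using nonempty by blast
    next
      case (insert F E)
      then obtain H where "H \<in> S" "\<forall>F\<in>E. H \<subseteq> F"
        by blast
      moreover then obtain H' where "H' \<in> S" "H' \<subseteq> F \<inter> H"
        using directed insert.prems by blast
      ultimately show ?case
        by blast
    qed
    \<comment> \<open>Finite intersection property: for finitely many indices \<open>E\<close>, a
      lower bound \<open>H\<close> in \<open>S\<close> yields the class \<open>b H\<close>, which
      contains its representative and lies in every \<open>b F\<close> with
      \<open>F \<in> E\<close>.\<close>
    have "\<Inter>(b ` S) \<noteq> {}"
    proof (rule compact_space_fip [THEN iffD1, OF comp, rule_format], intro conjI ballI allI impI)
      fix C assume "C \<in> b ` S"
      then obtain F where "F \<in> S" "C = b F"
        by blast
      then show "closedin \<tau> C"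
        using bF clopen_filter.clopen_class(2) [OF clopen_filter] by fastforce
    next
      fix D assume "finite D \<and> D \<subseteq> b ` S"
      then obtain E where E: "finite E" "E \<subseteq> S" "D = b ` E"
        by (meson finite_subset_image)
      then obtain H where H: "H \<in> S" "\<forall>F\<in>E. H \<subseteq> F"
        using lower by blast
      then obtain x where "x \<in> carrier L" "b H = filter_class L x H"
        using bF by blast
      then have "x \<in> b H"
        using reslat_filter.in_class_iff [OF rf] H by blast
      moreover have "b H \<subseteq> b F" if "F \<in> E" for F
        using that H E b_mono by blast
      ultimately show "\<Inter>D \<noteq> {}"
        using E by blast
    qed
    then obtain x where x: "\<And>F. F \<in> S \<Longrightarrow> x \<in> b F"
      by blast
    \<comment> \<open>A class is the class of each of its members, so the common point represents
      all coordinates of \<open>b\<close> simultaneously.\<close>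
    have cls: "x \<in> carrier L \<and> b F = filter_class L x F" if "F \<in> S" for F
      using bF [OF that] x [OF that] reslat_filter.in_class_iff [OF rf [OF that]] by auto
    have "b = h x"
      using b cls by (auto simp: carrier_M h_def PiE_def intro!: extensionalityI [of _ S])
    then show ?thesis
      using cls nonempty by blast
  qed
  have image: "h ` carrier L = carrier ?M"
    using h_in surj by blast
  have topspace_T: "topspace ?T = carrier ?M"
    by (auto simp: inverse_limit_topology_def carrier_M)
  have "homeomorphic_map \<tau> ?T h"
  proof (rule continuous_imp_homeomorphic_map [OF _ comp])
    show "Hausdorff_space ?T"
      unfolding inverse_limit_topology_def
      by (simp add: Hausdorff_space_subtopology Hausdorff_space_product_topology)
    show "continuous_map \<tau> ?T h"
      unfolding inverse_limit_topology_def continuous_map_in_subtopology continuous_map_componentwise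
      using h_in clopen_filter.continuous_class_map [OF clopen_filter]
      by (auto simp: ts h_def)
  qed (use image inj topspace_T ts in auto)
  then have "topologically_isomorphic L \<tau> ?M ?T"
    unfolding topologically_isomorphic_def bij_betw_def using hom inj image by blast
  then show ?thesis
    unfolding profinite_def profinite_over_def using sys fin by blast
qed

theorem theorem3p12:
  fixes L :: "('a, 'm) reslat_scheme" and \<tau> :: "'a topology"
  assumes "topological_residuated_lattice L \<tau>" and "compact_space \<tau>"
  shows "(profinite L \<tau> \<longleftrightarrow>
           (\<exists>S. (\<forall>F\<in>S. rl_filter L F \<and> openin \<tau> F \<and> closedin \<tau> F) \<and>
                (\<forall>F\<in>S. \<forall>G\<in>S. \<exists>H\<in>S. H \<subseteq> F \<inter> G) \<and>
                (\<forall>x\<in>carrier L. \<forall>y\<in>carrier L. x \<noteq> y \<longrightarrow>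
                   (\<exists>F\<in>S. filter_class L x F \<noteq> filter_class L y F)))) \<and>
         (profinite_over TYPE('i) TYPE('b) L \<tau> \<longrightarrow> profinite L \<tau>)"
    (is "(_ \<longleftrightarrow> ?filters) \<and> _")
proof -
  have "profinite L \<tau>" if filters: ?filters
  proof -
    interpret residuated_lattice L
      using assms(1) by (simp add: topological_residuated_lattice_def)
    obtain S where S: "\<forall>F\<in>S. rl_filter L F \<and> openin \<tau> F \<and> closedin \<tau> F"
      "\<forall>F\<in>S. \<forall>G\<in>S. \<exists>H\<in>S. H \<subseteq> F \<inter> G"
      "\<forall>x\<in>carrier L. \<forall>y\<in>carrier L. x \<noteq> y \<longrightarrow>
         (\<exists>F\<in>S. filter_class L x F \<noteq> filter_class L y F)"
      using filters by (elim exE conjE) (rule that)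
    have topspace: "topspace \<tau> = carrier L"
      using assms(1) by (simp add: topological_residuated_lattice_def)
    \<comment> \<open>The improper filter, clopen as the whole space, will be added to
      \<open>S\<close>.\<close>
    have carrier: "rl_filter L (carrier L)" "openin \<tau> (carrier L)" "closedin \<tau> (carrier L)"
      using one_closed openin_topspace [of \<tau>] closedin_topspace [of \<tau>]
      unfolding topspace by (auto simp: rl_filter_def)
    have subset: "F \<subseteq> carrier L" if "F \<in> S" for F
      using S(1) that by (simp add: rl_filter_def)
    \<comment> \<open>For trivial \<open>L\<close> the set \<open>S\<close> may be empty, but the index set of an inverse system may not.\<close>
    show ?thesis
    proof (rule clopen_filters_imp_profinite [OF assms, of "insert (carrier L) S"])
      fix F G assume FG: "F \<in> insert (carrier L) S" "G \<in> insert (carrier L) S"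
      \<comment> \<open>If one of the two is the carrier, the other is itself contained in the
        intersection.\<close>
      then consider "F = carrier L" | "G = carrier L" | "F \<in> S" "G \<in> S"
        by blast
      then show "\<exists>H\<in>insert (carrier L) S. H \<subseteq> F \<inter> G"
      proof cases
        case 1
        then show ?thesis
          using FG subset by (intro bexI [of _ G]) auto
      next
        case 2
        then show ?thesis
          using FG subset by (intro bexI [of _ F]) auto
      next
        case 3
        then show ?thesis
          using S(2) [rule_format, of F G] by auto
      qed
    next
      fix x y assume "x \<in> carrier L" "y \<in> carrier L" "x \<noteq> y"
      then show "\<exists>F\<in>insert (carrier L) S. filter_class L x F \<noteq> filter_class L y F"
        using S(3) [rule_format, of x y] by auto
    qed (use S(1) carrier in auto)
  qed
  moreover have ?filters if "profinite L \<tau>"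
    using profinite_over_imp_clopen_filters [OF assms(1) that [unfolded profinite_def]] .
  \<comment> \<open>The kernels are subsets of \<open>L\<close> whatever the types \<open>'i\<close>
    and \<open>'b\<close>; rebuilding the system from them gives indices and carriers of the types
    fixed in \<open>profinite\<close>.\<close>
  moreover have ?filters if "profinite_over TYPE('i) TYPE('b) L \<tau>"
    using profinite_over_imp_clopen_filters [OF assms(1) that] .
  ultimately show ?thesis
    by argo
qed

end
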